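(* Let $n\ge k\ge 2$ and let $G$ be a connected $k$-uniform linear hypergraph with vertex set $[n]$. For any $v\in[n]$, $$\rho(G-v)\ge \rho(G)-\sqrt[k-1]{\frac{d_G(v)}{\rho(G)}},$$ with equality if and only if $v$ is adjacent to every other vertex of $G$ and $G-v$ is regular.
   Context: $[n]=\{1,\dots,n\}$. A $k$-uniform hypergraph $G$ has vertex set $V(G)$ and edge set $E(G)$ consisting of $k$-element subsets of $V(G)$; it is linear if every two distinct edges intersect in at most one vertex. Two distinct vertices are adjacent if some edge contains both. The degree $d_G(v)$ is the number of edges containing $v$; a hypergraph is regular if all its vertices have the same degree. The adjacency tensor $\mathcal{A}(G)=(a_{i_1\dots i_k})$ has order $k$ and dimension $|V(G)|$, with $a_{i_1\dots i_k}=\frac{1}{(k-1)!}$ if $\{i_1,\dots,i_k\}\in E(G)$ and $0$ otherwise. A complex number $\lambda$ is an eigenvalue of $\mathcal{A}(G)$ with eigenvector $\mathbf{x}\ne 0$ if $\lambda x_u^{k-1}=\sum_{e\in E(G),\,u\in e}\prod_{w\in e\setminus\{u\}}x_w$ for all $u\in V(G)$. The spectral radius $\rho(G)$ is the largest modulus of the eigenvalues of $\mathcal{A}(G)$ (equal to its largest H-eigenvalue, i.e. largest real eigenvalue with a real eigenvector). $G-v$ is the hypergraph with vertex set $V(G)\setminus\{v\}$ whose edges are the edges of $G$ not containing $v$. *)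

theory Defs
  imports "HOL-Analysis.Analysis" "HOL-Combinatorics.Multiset_Permutations"
begin

record 'a hypergraph =
  hverts :: "'a set"
  hedges :: "'a set set"

definition uniform_hypergraph :: "nat \<Rightarrow> 'a hypergraph \<Rightarrow> bool" where
  "uniform_hypergraph k G \<longleftrightarrow>
     finite (hverts G) \<and> (\<forall>e\<in>hedges G. e \<subseteq> hverts G \<and> card e = k)"

definition linear_hypergraph :: "'a hypergraph \<Rightarrow> bool" where
  "linear_hypergraph G \<longleftrightarrow>
     (\<forall>e\<in>hedges G. \<forall>f\<in>hedges G. e \<noteq> f \<longrightarrow> finite (e \<inter> f) \<and> card (e \<inter> f) \<le> 1)"

definition hadjacent :: "'a hypergraph \<Rightarrow> 'a \<Rightarrow> 'a \<Rightarrow> bool" where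
  "hadjacent G u v \<longleftrightarrow> u \<noteq> v \<and> (\<exists>e\<in>hedges G. u \<in> e \<and> v \<in> e)"

definition connected_hypergraph :: "'a hypergraph \<Rightarrow> bool" where
  "connected_hypergraph G \<longleftrightarrow> hverts G \<noteq> {} \<and>
     (\<forall>u\<in>hverts G. \<forall>v\<in>hverts G. (hadjacent G)\<^sup>*\<^sup>* u v)"

definition hdegree :: "'a hypergraph \<Rightarrow> 'a \<Rightarrow> nat" where
  "hdegree G v = card {e \<in> hedges G. v \<in> e}"

definition regular_hypergraph :: "'a hypergraph \<Rightarrow> bool" where
  "regular_hypergraph G \<longleftrightarrow> (\<exists>r. \<forall>v\<in>hverts G. hdegree G v = r)"

definition delete_vertex :: "'a hypergraph \<Rightarrow> 'a \<Rightarrow> 'a hypergraph" where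
  "delete_vertex G v =
     \<lparr>hverts = hverts G - {v}, hedges = {e \<in> hedges G. v \<notin> e}\<rparr>"

text \<open>
  A tensor of order \<open>k\<close> with index set \<open>V\<close> is a function on lists; only its values on lists of
  length \<open>k\<close> over \<open>V\<close> matter.  Likewise a vector indexed by \<open>V\<close> is a function of which only the
  values on \<open>V\<close> matter, so it is nonzero iff it has a nonzero component in \<open>V\<close>.
\<close>

definition tensor_apply ::
  "nat \<Rightarrow> 'a set \<Rightarrow> ('a list \<Rightarrow> complex) \<Rightarrow> ('a \<Rightarrow> complex) \<Rightarrow> 'a \<Rightarrow> complex" where
  "tensor_apply k V T x u =
     (\<Sum>js | set js \<subseteq> V \<and> length js = k - 1. T (u # js) * prod_list (map x js))"

definition tensor_eigenvalue ::
  "nat \<Rightarrow> 'a set \<Rightarrow> ('a list \<Rightarrow> complex) \<Rightarrow> complex \<Rightarrow> bool" where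
  "tensor_eigenvalue k V T \<mu> \<longleftrightarrow>
     (\<exists>x. (\<exists>u\<in>V. x u \<noteq> 0) \<and> (\<forall>u\<in>V. \<mu> * x u ^ (k - 1) = tensor_apply k V T x u))"

text \<open>
  The order \<open>k\<close> is an explicit argument, as it cannot be recovered from a hypergraph without edges.
\<close>

definition adjacency_tensor :: "nat \<Rightarrow> 'a hypergraph \<Rightarrow> 'a list \<Rightarrow> complex" where
  "adjacency_tensor k G js =
     (if length js = k \<and> set js \<in> hedges G then 1 / fact (k - 1) else 0)"

definition adjacency_eigenvalue :: "nat \<Rightarrow> 'a hypergraph \<Rightarrow> complex \<Rightarrow> bool" where
  "adjacency_eigenvalue k G = tensor_eigenvalue k (hverts G) (adjacency_tensor k G)"

definition spectral_radius :: "nat \<Rightarrow> 'a hypergraph \<Rightarrow> real" where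
  "spectral_radius k G = (GREATEST r. \<exists>\<mu>. adjacency_eigenvalue k G \<mu> \<and> r = cmod \<mu>)"

text \<open>
  The factor \<open>1 / (k - 1)!\<close> in the adjacency tensor cancels the number of orderings of
  \<open>e - {u}\<close>, which gives the usual form of the eigenvalue equations of a hypergraph.
\<close>

lemma tensor_apply_adjacency:
  assumes G: "uniform_hypergraph k G" and k: "k \<ge> 1" and u: "u \<in> hverts G"
  shows "tensor_apply k (hverts G) (adjacency_tensor k G) x u =
           (\<Sum>e | e \<in> hedges G \<and> u \<in> e. \<Prod>w\<in>e - {u}. x w)"
proof -
  let ?V = "hverts G" and ?E = "{e \<in> hedges G. u \<in> e}"
  let ?L = "{js. set js \<subseteq> ?V \<and> length js = k - 1}"
  let ?P = "\<lambda>e. permutations_of_set (e - {u})"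
  have finV: "finite ?V" and sub: "\<And>e. e \<in> hedges G \<Longrightarrow> e \<subseteq> ?V"
    and crd: "\<And>e. e \<in> hedges G \<Longrightarrow> card e = k"
    using G by (auto simp: uniform_hypergraph_def)
  have fine: "\<And>e. e \<in> hedges G \<Longrightarrow> finite e" using sub finV finite_subset by blast
  have finE: "finite ?E"
    by (rule finite_subset[of _ "Pow ?V"]) (use sub finV in auto)
  have finL: "finite ?L" using finV by (rule finite_lists_length_eq)
  have cardm: "card (e - {u}) = k - 1" if "e \<in> ?E" for e
    using that crd fine by simp
  have UnP: "(\<Union>e\<in>?E. ?P e) = {js \<in> ?L. set (u # js) \<in> hedges G}" (is "?A = ?B")
  proof
    show "?A \<subseteq> ?B"
    proof
      fix js assume "js \<in> ?A"
      then obtain e where e: "e \<in> ?E" and js: "js \<in> ?P e" by blast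
      have s: "set js = e - {u}" and d: "distinct js" using js by (auto simp: permutations_of_set_def)
      have "length js = k - 1" using cardm[OF e] s d distinct_card by fastforce
      moreover have "set (u # js) = e" using s e by auto
      ultimately show "js \<in> ?B" using s e sub by auto
    qed
    show "?B \<subseteq> ?A"
    proof
      fix js assume js: "js \<in> ?B"
      have "card (set (u # js)) = length (u # js)" using js crd k by fastforce
      hence "distinct (u # js)" by (rule card_distinct)
      hence "js \<in> ?P (set (u # js))" by (auto simp: permutations_of_set_def)
      thus "js \<in> ?A" using js by fastforce
    qed
  qed
  have "tensor_apply k ?V (adjacency_tensor k G) x u =
          (\<Sum>js\<in>?L. if set (u # js) \<in> hedges G then prod_list (map x js) / fact (k - 1) else 0)"
    unfolding tensor_apply_def by (rule sum.cong) (use k in \<open>auto simp: adjacency_tensor_def\<close>)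
  also have "\<dots> = (\<Sum>js\<in>{js \<in> ?L. set (u # js) \<in> hedges G}. prod_list (map x js) / fact (k - 1))"
    by (rule sum.inter_filter[symmetric]) (rule finL)
  also have "\<dots> = (\<Sum>js\<in>(\<Union>e\<in>?E. ?P e). prod_list (map x js) / fact (k - 1))"
    by (simp only: UnP)
  also have "\<dots> = (\<Sum>e\<in>?E. \<Sum>js\<in>?P e. prod_list (map x js) / fact (k - 1))"
  proof (rule sum.UNION_disjoint[OF finE])
    show "\<forall>e\<in>?E. finite (?P e)" by simp
    show "\<forall>e\<in>?E. \<forall>f\<in>?E. e \<noteq> f \<longrightarrow> ?P e \<inter> ?P f = {}"
      by (auto simp: permutations_of_set_def)
  qed
  also have "\<dots> = (\<Sum>e\<in>?E. \<Prod>w\<in>e - {u}. x w)"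
  proof (rule sum.cong[OF refl])
    fix e assume e: "e \<in> ?E"
    have "(\<Sum>js\<in>?P e. prod_list (map x js) / fact (k - 1)) =
            (\<Sum>js\<in>?P e. (\<Prod>w\<in>e - {u}. x w) / fact (k - 1))"
      by (rule sum.cong) (auto simp: permutations_of_set_def prod.distinct_set_conv_list[symmetric])
    also have "\<dots> = (\<Prod>w\<in>e - {u}. x w)"
      using e fine cardm[OF e] by simp
    finally show "(\<Sum>js\<in>?P e. prod_list (map x js) / fact (k - 1)) = (\<Prod>w\<in>e - {u}. x w)" .
  qed
  finally show ?thesis by simp
qed

lemma adjacency_eigenvalue_iff:
  assumes "uniform_hypergraph k G" and "k \<ge> 1"
  shows "adjacency_eigenvalue k G \<mu> \<longleftrightarrow>
           (\<exists>x. (\<exists>u\<in>hverts G. x u \<noteq> 0) \<and>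
                (\<forall>u\<in>hverts G. \<mu> * x u ^ (k - 1) =
                   (\<Sum>e | e \<in> hedges G \<and> u \<in> e. \<Prod>w\<in>e - {u}. x w)))"
  using assms
  by (simp add: adjacency_eigenvalue_def tensor_eigenvalue_def tensor_apply_adjacency)

end

theory Submission
  imports Defs
begin

text \<open>
  Write \<open>f(x)\<close> for the sum over the edges of the products of the entries of \<open>x\<close>.  The spectral radius
  is the maximum of the Rayleigh quotient \<open>k f(x) / (\<Sum>u. x u ^ k)\<close> over nonzero \<open>x \<ge> 0\<close>: taking moduli
  in an eigenvalue equation and summing shows that no eigenvalue is larger in modulus
  (\<open>cmod_eigenvalue_le_rayleigh_bound\<close>), and a maximizer, which exists by compactness, satisfies the
  eigenvalue equations (\<open>rayleigh_maximizer_eigenvector\<close>).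

  Let \<open>\<rho>\<close> be the spectral radius of \<open>G\<close>, let \<open>x\<close> be a maximizer for \<open>G\<close>, which is positive because \<open>G\<close> is
  connected (\<open>connected_maximizer_positive\<close>), and put \<open>p = x v\<close> and \<open>S = (\<Sum>w\<noteq>v. x w ^ k)\<close>.  The edges
  through \<open>v\<close> contribute \<open>\<rho> p ^ k\<close> to \<open>f(x)\<close>, so the restriction of \<open>x\<close> to \<open>G - v\<close>, as a trial vector,
  gives \<open>\<rho>(G - v) S \<ge> \<rho> S - (k - 1) \<rho> p ^ k\<close>.  It remains to show \<open>(k - 1) \<rho> p ^ k \<le> a S\<close> for the number
  \<open>a > 0\<close> with \<open>\<rho> a ^ (k - 1) = d(v)\<close>.  In the extremal hypergraphs \<open>x\<close> takes the value \<open>p / a\<close> at all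
  other vertices.  This suggests to apply the inequality of arithmetic and geometric means, in every
  edge through \<open>v\<close>, to the entries of \<open>x\<close> with the entry at \<open>v\<close> replaced by \<open>p / a\<close>
  (\<open>link_form_arith_geom_mean\<close>).  Summing over these edges gives
  \<open>k \<rho> p ^ k / a \<le> d(v) (p / a) ^ k + S\<close>, since by linearity every neighbour of \<open>v\<close> occurs in only one
  of them, and \<open>d(v) (p / a) ^ k = \<rho> p ^ k / a\<close>.

  Equality forces every vertex other than \<open>v\<close> to be a neighbour, forces \<open>x\<close> to be constant on
  \<open>G - v\<close>, and makes this constant vector a maximizer, hence an eigenvector, of \<open>G - v\<close>; so
  \<open>G - v\<close> is regular.  Conversely, if \<open>v\<close> is adjacent to all other vertices and \<open>G - v\<close> is regular,
  then some vector that is \<open>1\<close> outside \<open>v\<close> is a positive eigenvector of \<open>G\<close>, and a positive eigenvector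
  always belongs to the spectral radius (\<open>spectral_radius_positive_eigenvector\<close>).
\<close>

section \<open>Elementary inequalities\<close>

lemma nonpos_of_le_small_multiples:
  fixes a m :: real
  assumes "\<And>e. 0 < e \<Longrightarrow> e \<le> 1 \<Longrightarrow> a \<le> m * e"
  shows "a \<le> 0"
proof (rule ccontr)
  assume "\<not> a \<le> 0"
  hence a: "a > 0" by simp
  have m: "m > 0" using assms[of 1] a by simp
  define e where "e = min 1 (a / (2 * m))"
  have "e > 0" "e \<le> 1" "e \<le> a / (2 * m)" using a m by (auto simp: e_def)
  hence "a \<le> m * (a / (2 * m))" using assms[of e] m
    by (meson mult_left_mono less_imp_le order_trans)
  thus False using a m by simp
qed

text \<open>
  The one-variable form of stationarity at a maximizer on the nonnegative orthant: at an interior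
  minimum the derivative vanishes, and at the boundary point \<open>p = 0\<close> the linear term would dominate
  the power if \<open>A\<close> were positive.
\<close>

lemma power_minus_linear_min:
  fixes A M p :: real
  assumes k: "k \<ge> 2" and p: "p \<ge> 0" and A: "A \<ge> 0"
    and min: "\<And>s. s \<ge> 0 \<Longrightarrow> M * p ^ k - k * A * p \<le> M * s ^ k - k * A * s"
  shows "A = M * p ^ (k - 1)"
proof (cases "p = 0")
  case False
  hence p: "p > 0" using p by simp
  let ?f = "\<lambda>s. M * s ^ k - k * A * s"
  have d: "(?f has_real_derivative M * (k * p ^ (k - 1)) - k * A) (at p)"
    by (auto intro!: derivative_eq_intros)
  have "M * (k * p ^ (k - 1)) - k * A = 0"
    by (rule DERIV_local_min[OF d p]) (use min p in \<open>auto simp: abs_less_iff\<close>)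
  hence "k * (M * p ^ (k - 1) - A) = 0" by (simp add: algebra_simps)
  thus ?thesis using k by simp
next
  case True
  have "M * p ^ k - k * A * p = 0" using True k by simp
  hence min0: "k * A * s \<le> M * s ^ k" if "s \<ge> 0" for s using min[OF that] by simp
  have "k * A \<le> 0"
  proof (rule nonpos_of_le_small_multiples)
    fix e :: real assume e: "0 < e" "e \<le> 1"
    have M: "M \<ge> 0"
    proof -
      have "k * A \<le> M" using min0[of 1] by simp
      thus ?thesis using A by (smt (verit) mult_nonneg_nonneg of_nat_0_le_iff)
    qed
    have "k * A * e \<le> M * e ^ k" using min0[of e] e(1) by simp
    also have "\<dots> \<le> M * e ^ 2"
      by (rule mult_left_mono[OF power_decreasing[OF k] M]) (use e in simp_all)
    finally have "(k * A) * e \<le> (M * e) * e" by (simp add: power2_eq_square)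
    thus "k * A \<le> M * e" using e(1) by (rule mult_right_le_imp_le)
  qed
  hence "A = 0" using A k by (simp add: mult_le_0_iff)
  thus ?thesis using True k by simp
qed

text \<open>
  Dividing the powers by the product gives numbers \<open>z i\<close> with product \<open>1\<close>, and
  \<open>ln z \<le> z - 1\<close>, which is strict unless \<open>z = 1\<close>, yields both the inequality and its equality case.
\<close>

lemma arith_geom_mean_powers:
  fixes y :: "'a \<Rightarrow> real"
  assumes fin: "finite e" and pos: "\<And>i. i \<in> e \<Longrightarrow> y i > 0"
  shows arith_geom_mean_powers_le: "card e * (\<Prod>i\<in>e. y i) \<le> (\<Sum>i\<in>e. y i ^ card e)"
    and arith_geom_mean_powers_eq:
      "card e * (\<Prod>i\<in>e. y i) = (\<Sum>i\<in>e. y i ^ card e) \<Longrightarrow> i \<in> e \<Longrightarrow> j \<in> e \<Longrightarrow> y i = y j"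
proof -
  define Q where "Q = (\<Prod>i\<in>e. y i)"
  have Q: "Q > 0" unfolding Q_def using pos by (rule prod_pos)
  define z where "z i = y i ^ card e / Q" for i
  have z: "z i > 0" if "i \<in> e" for i using pos[OF that] Q by (simp add: z_def)
  have "(\<Prod>i\<in>e. z i) = 1"
    using Q by (simp add: z_def prod_dividef prod_power_distrib[symmetric] Q_def[symmetric])
  hence ln0: "(\<Sum>i\<in>e. ln (z i)) = 0"
    using z ln_prod[of e z] fin by (metis ln_one less_numeral_extra(3) order_less_irrefl)
  have le: "ln (z i) \<le> z i - 1" if "i \<in> e" for i
    using ln_le_minus_one z that by blast
  have s: "(\<Sum>i\<in>e. y i ^ card e) - card e * Q = Q * (\<Sum>i\<in>e. z i - 1 - ln (z i))"
  proof -
    have "(\<Sum>i\<in>e. z i - 1 - ln (z i)) = (\<Sum>i\<in>e. z i) - card e" using ln0 by (simp add: sum_subtractf)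
    moreover have "Q * (\<Sum>i\<in>e. z i) = (\<Sum>i\<in>e. y i ^ card e)"
      unfolding sum_distrib_left by (rule sum.cong) (use Q in \<open>auto simp: z_def\<close>)
    ultimately show ?thesis by (simp only: right_diff_distrib mult.commute[of Q "real (card e)"])
  qed
  have "(\<Sum>i\<in>e. z i - 1 - ln (z i)) \<ge> 0" by (rule sum_nonneg) (use le in force)
  thus "card e * (\<Prod>i\<in>e. y i) \<le> (\<Sum>i\<in>e. y i ^ card e)"
    using s Q unfolding Q_def[symmetric] by (smt (verit) mult_nonneg_nonneg)
  assume eq: "card e * (\<Prod>i\<in>e. y i) = (\<Sum>i\<in>e. y i ^ card e)" and ij: "i \<in> e" "j \<in> e"
  have "(\<Sum>i\<in>e. z i - 1 - ln (z i)) = 0" using s Q eq by (simp add: Q_def)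
  hence *: "z l = 1" if "l \<in> e" for l
    using sum_nonneg_eq_0_iff[OF fin, of "\<lambda>i. z i - 1 - ln (z i)"] le that z
    by (smt (verit) ln_eq_minus_one)
  have "y i ^ card e = y j ^ card e" using *[OF ij(1)] *[OF ij(2)] Q by (simp add: z_def)
  moreover have "card e > 0" using fin ij card_gt_0_iff by blast
  ultimately show "y i = y j"
    using power_eq_imp_eq_base[of "y i" "card e" "y j"] pos[OF ij(1)] pos[OF ij(2)] by simp
qed

section \<open>The homogeneous form of a hypergraph\<close>

definition edge_form :: "'a hypergraph \<Rightarrow> ('a \<Rightarrow> 'b::comm_semiring_1) \<Rightarrow> 'b" where
  "edge_form H x = (\<Sum>e\<in>hedges H. \<Prod>w\<in>e. x w)"

text \<open>
  This is the partial derivative of the edge form with respect to the entry at \<open>u\<close>, and also the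
  right-hand side of the eigenvalue equation at \<open>u\<close>.  It is polymorphic because eigenvectors are
  complex, whereas maximizers are real.
\<close>

definition link_form :: "'a hypergraph \<Rightarrow> ('a \<Rightarrow> 'b::comm_semiring_1) \<Rightarrow> 'a \<Rightarrow> 'b" where
  "link_form H x u = (\<Sum>e | e \<in> hedges H \<and> u \<in> e. \<Prod>w\<in>e - {u}. x w)"

lemma uniform_hypergraphD:
  assumes "uniform_hypergraph k H"
  shows "finite (hverts H)" "finite (hedges H)"
    "\<And>e. e \<in> hedges H \<Longrightarrow> e \<subseteq> hverts H"
    "\<And>e. e \<in> hedges H \<Longrightarrow> card e = k" "\<And>e. e \<in> hedges H \<Longrightarrow> finite e"
proof -
  show 1: "finite (hverts H)" and 2: "\<And>e. e \<in> hedges H \<Longrightarrow> e \<subseteq> hverts H"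
    and "\<And>e. e \<in> hedges H \<Longrightarrow> card e = k"
    using assms by (auto simp: uniform_hypergraph_def)
  show "finite (hedges H)" by (rule finite_subset[of _ "Pow (hverts H)"]) (use 1 2 in auto)
  show "\<And>e. e \<in> hedges H \<Longrightarrow> finite e" using 1 2 finite_subset by blast
qed

lemma uniform_delete_vertex:
  "uniform_hypergraph k H \<Longrightarrow> uniform_hypergraph k (delete_vertex H v)"
  by (auto simp: uniform_hypergraph_def delete_vertex_def)

lemma edge_form_split:
  assumes H: "uniform_hypergraph k H"
  shows "edge_form H x = x u * link_form H x u + edge_form (delete_vertex H u) x"
proof -
  have "edge_form H x = (\<Sum>e | e \<in> hedges H \<and> u \<in> e. \<Prod>w\<in>e. x w)
      + (\<Sum>e | e \<in> hedges H \<and> u \<notin> e. \<Prod>w\<in>e. x w)"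
    unfolding edge_form_def using uniform_hypergraphD(2)[OF H]
    by (subst sum.union_disjoint[symmetric]) (auto intro!: sum.cong)
  also have "(\<Sum>e | e \<in> hedges H \<and> u \<in> e. \<Prod>w\<in>e. x w) = x u * link_form H x u"
    unfolding link_form_def sum_distrib_left
    by (rule sum.cong) (use uniform_hypergraphD(5)[OF H] in \<open>auto simp: prod.remove\<close>)
  finally show ?thesis by (simp add: edge_form_def delete_vertex_def)
qed

lemma edge_form_cong:
  "(\<And>e w. e \<in> hedges H \<Longrightarrow> w \<in> e \<Longrightarrow> x w = y w) \<Longrightarrow> edge_form H x = edge_form H y"
  unfolding edge_form_def by (intro sum.cong prod.cong) auto

text \<open>
  Neither the link form at \<open>u\<close> nor the edge form of the remaining edges involves the entry at \<open>u\<close>, so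
  the edge form is affine in that entry.
\<close>

lemma edge_form_update:
  assumes "uniform_hypergraph k H"
  shows "edge_form H (x(u := s)) = s * link_form H x u + edge_form (delete_vertex H u) x"
proof -
  have "link_form H (x(u := s)) u = link_form H x u"
    unfolding link_form_def by (intro sum.cong prod.cong) auto
  moreover have "edge_form (delete_vertex H u) (x(u := s)) = edge_form (delete_vertex H u) x"
    by (rule edge_form_cong) (auto simp: delete_vertex_def)
  ultimately show ?thesis using edge_form_split[OF assms, of "x(u := s)" u] by simp
qed

text \<open>
  Euler's identity for a homogeneous form of degree \<open>k\<close>.
\<close>

lemma sum_mult_link_form:
  assumes H: "uniform_hypergraph k H"
  shows "(\<Sum>u\<in>hverts H. x u * link_form H x u) = of_nat k * edge_form H x"
proof -
  note D = uniform_hypergraphD[OF H]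
  have "(\<Sum>u\<in>hverts H. x u * link_form H x u)
      = (\<Sum>u\<in>hverts H. \<Sum>e | e \<in> hedges H \<and> u \<in> e. \<Prod>w\<in>e. x w)"
    unfolding link_form_def sum_distrib_left
    by (intro sum.cong refl) (use D in \<open>auto simp: prod.remove\<close>)
  also have "\<dots> = (\<Sum>e\<in>hedges H. \<Sum>u | u \<in> hverts H \<and> u \<in> e. \<Prod>w\<in>e. x w)"
    using D(1,2) by (rule sum.swap_restrict)
  also have "\<dots> = (\<Sum>e\<in>hedges H. of_nat k * (\<Prod>w\<in>e. x w))"
  proof (intro sum.cong refl)
    fix e assume e: "e \<in> hedges H"
    have "{u \<in> hverts H. u \<in> e} = e" using D(3)[OF e] by auto
    thus "(\<Sum>u | u \<in> hverts H \<and> u \<in> e. \<Prod>w\<in>e. x w) = of_nat k * (\<Prod>w\<in>e. x w)"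
      using D(4)[OF e] by simp
  qed
  finally show ?thesis by (simp add: edge_form_def sum_distrib_left)
qed

lemma link_form_mono:
  fixes x y :: "'a \<Rightarrow> 'b::linordered_idom"
  assumes H: "uniform_hypergraph k H" and "\<And>w. w \<in> hverts H \<Longrightarrow> 0 \<le> x w \<and> x w \<le> y w"
  shows "link_form H x u \<le> link_form H y u"
  unfolding link_form_def
  by (intro sum_mono prod_mono) (use assms(2) uniform_hypergraphD(3)[OF H] in blast)

lemma link_form_nonneg:
  fixes x :: "'a \<Rightarrow> real"
  assumes H: "uniform_hypergraph k H" and "\<And>w. w \<in> hverts H \<Longrightarrow> 0 \<le> x w"
  shows "link_form H x u \<ge> 0"
  unfolding link_form_def
  by (intro sum_nonneg prod_nonneg) (use assms(2) uniform_hypergraphD(3)[OF H] in blast)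

lemma link_form_scale:
  assumes H: "uniform_hypergraph k H"
  shows "link_form H (\<lambda>w. c * x w) u = c ^ (k - 1) * link_form H x u"
  unfolding link_form_def sum_distrib_left
  by (intro sum.cong refl) (use uniform_hypergraphD(4,5)[OF H] in \<open>auto simp: prod.distrib\<close>)

lemma link_form_const:
  assumes H: "uniform_hypergraph k H"
  shows "link_form H (\<lambda>w. c) u = c ^ (k - 1) * of_nat (hdegree H u)"
proof -
  have "link_form H (\<lambda>w. c) u = (\<Sum>e | e \<in> hedges H \<and> u \<in> e. c ^ (k - 1))"
    unfolding link_form_def
    by (intro sum.cong refl) (use uniform_hypergraphD(4,5)[OF H] in auto)
  thus ?thesis by (simp add: hdegree_def mult.commute)
qed

lemma edge_form_scale:
  assumes H: "uniform_hypergraph k H"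
  shows "edge_form H (\<lambda>w. c * x w) = c ^ k * edge_form H x"
  unfolding edge_form_def sum_distrib_left
  by (intro sum.cong refl) (use uniform_hypergraphD(4,5)[OF H] in \<open>auto simp: prod.distrib\<close>)

section \<open>The spectral radius as the maximum of a Rayleigh quotient\<close>

definition rayleigh_bound :: "nat \<Rightarrow> 'a hypergraph \<Rightarrow> real \<Rightarrow> bool" where
  "rayleigh_bound k H M \<longleftrightarrow>
     (\<forall>y :: 'a \<Rightarrow> real. (\<forall>u\<in>hverts H. y u \<ge> 0) \<longrightarrow> k * edge_form H y \<le> M * (\<Sum>u\<in>hverts H. y u ^ k))"

text \<open>
  Vectors that vanish outside the vertex set and have entries in \<open>[0, 1]\<close> on it form a compact set in
  the product topology, by Tychonoff's theorem, so the form attains its maximum on those with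
  \<open>(\<Sum>u. x u ^ k) = 1\<close>.  Homogeneity extends the bound to all nonnegative vectors.
\<close>

lemma rayleigh_maximum_exists:
  assumes H: "uniform_hypergraph k H" and k: "k \<ge> 1" and ne: "hverts H \<noteq> {}"
  obtains M and x :: "'a \<Rightarrow> real" where "rayleigh_bound k H M" "\<forall>u\<in>hverts H. x u \<ge> 0" "\<exists>u\<in>hverts H. x u > 0"
    "k * edge_form H x = M * (\<Sum>u\<in>hverts H. x u ^ k)"
proof -
  let ?V = "hverts H"
  note D = uniform_hypergraphD[OF H]
  define K :: "('a \<Rightarrow> real) set" where "K = PiE UNIV (\<lambda>i. if i \<in> ?V then {0..1} else {0})"
  define S where "S = K \<inter> {x. (\<Sum>u\<in>?V. x u ^ k) = 1}"
  have cont: "continuous_on A (\<lambda>x::'a \<Rightarrow> real. x i)" for A i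
    by (rule continuous_on_subset[OF continuous_on_product_coordinates]) simp
  have "compactin (product_topology (\<lambda>i::'a. euclidean) UNIV) K"
    unfolding K_def compactin_PiE by auto
  hence "compact K" by (simp add: euclidean_product_topology)
  hence cS: "compact S" unfolding S_def
    by (rule compact_Int_closed) (intro closed_Collect_eq continuous_intros cont)
  obtain u0 where u0: "u0 \<in> ?V" using ne by blast
  have "(\<lambda>i. if i = u0 then 1 else 0) \<in> S"
    using u0 D(1) k by (auto simp: S_def K_def if_distrib[of "\<lambda>x. x ^ k"] zero_power cong: if_cong)
  hence "S \<noteq> {}" by blast
  moreover have "continuous_on S (edge_form H :: ('a \<Rightarrow> real) \<Rightarrow> real)"
    unfolding edge_form_def by (intro continuous_intros cont)
  ultimately obtain x where x: "x \<in> S" and max: "\<And>y. y \<in> S \<Longrightarrow> edge_form H y \<le> edge_form H x"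
    using continuous_attains_sup[OF cS] by blast
  have x0: "x u \<ge> 0" if "u \<in> ?V" for u
    using x that by (auto simp: S_def K_def PiE_def Pi_def split: if_splits)
  have x1: "(\<Sum>u\<in>?V. x u ^ k) = 1" using x by (simp add: S_def)
  show ?thesis
  proof
    show "k * edge_form H x = (k * edge_form H x) * (\<Sum>u\<in>?V. x u ^ k)" using x1 by simp
    show "\<forall>u\<in>?V. x u \<ge> 0" using x0 by blast
    show "\<exists>u\<in>?V. x u > 0"
    proof (rule ccontr)
      assume "\<not> ?thesis"
      hence "\<forall>u\<in>?V. x u = 0" using x0 by force
      hence "(\<Sum>u\<in>?V. x u ^ k) = 0" using k by (simp add: zero_power)
      thus False using x1 by simp
    qed
    show "rayleigh_bound k H (k * edge_form H x)"
      unfolding rayleigh_bound_def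
    proof (intro allI impI)
      fix y :: "'a \<Rightarrow> real" assume y: "\<forall>u\<in>?V. y u \<ge> 0"
      define s where "s = (\<Sum>u\<in>?V. y u ^ k)"
      have s0: "s \<ge> 0" unfolding s_def by (rule sum_nonneg) (use y in simp)
      have ys: "y u ^ k \<le> s" if "u \<in> ?V" for u
        unfolding s_def by (rule member_le_sum) (use y that D(1) in auto)
      have "edge_form H y \<le> s * edge_form H x"
      proof (cases "s = 0")
        case True
        hence y0: "y u = 0" if "u \<in> ?V" for u
          using ys[OF that] y that k by (smt (verit) zero_less_power)
        have "edge_form H y = 0" unfolding edge_form_def
        proof (intro sum.neutral ballI)
          fix e assume e: "e \<in> hedges H"
          hence "e \<noteq> {}" using D(4) k by fastforce
          then obtain w where "w \<in> e" by blast
          thus "(\<Prod>w\<in>e. y w) = 0" using y0 D(3,5) e by (meson prod_zero subsetD)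
        qed
        thus ?thesis using True by simp
      next
        case False
        define c where "c = root k s"
        have c: "c > 0" "c ^ k = s" using False s0 k by (auto simp: c_def)
        define z where "z u = (if u \<in> ?V then (1 / c) * y u else 0)" for u
        have "y u \<le> c" if "u \<in> ?V" for u
          using ys[OF that] c k y that
          by (metis Suc_diff_1 less_le_trans less_numeral_extra(1) less_imp_le power_le_imp_le_base)
        hence "z \<in> K" using y c by (auto simp: K_def z_def)
        moreover have "(\<Sum>u\<in>?V. z u ^ k) = (\<Sum>u\<in>?V. y u ^ k) / c ^ k"
          unfolding sum_divide_distrib by (rule sum.cong) (auto simp: z_def power_divide)
        ultimately have "z \<in> S" using c False by (simp add: S_def s_def)
        hence "edge_form H z \<le> edge_form H x" by (rule max)
        moreover have "edge_form H z = edge_form H (\<lambda>w. (1 / c) * y w)"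
          by (rule edge_form_cong) (use D(3) in \<open>auto simp: z_def\<close>)
        ultimately have "edge_form H y / c ^ k \<le> edge_form H x"
          unfolding edge_form_scale[OF H] by (simp add: power_divide)
        hence "edge_form H y \<le> edge_form H x * c ^ k" by (rule pos_divide_le_eq[THEN iffD1, rotated]) (use c(1) in simp)
        thus ?thesis using c by (simp add: mult.commute)
      qed
      hence "real k * edge_form H y \<le> real k * (s * edge_form H x)" by (rule mult_left_mono) simp
      thus "k * edge_form H y \<le> k * edge_form H x * (\<Sum>u\<in>?V. y u ^ k)"
        unfolding s_def[symmetric] by (simp add: mult_ac)
    qed
  qed
qed

text \<open>
  If only the entry at \<open>u\<close> varies, the difference of the two sides of the Rayleigh bound is
  \<open>M * s ^ k - k * s * link_form H x u\<close> up to a constant, and it is minimal at \<open>s = x u\<close>.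
\<close>

lemma rayleigh_maximizer_eigenvector:
  fixes x :: "'a \<Rightarrow> real"
  assumes H: "uniform_hypergraph k H" and k: "k \<ge> 2" and M: "rayleigh_bound k H M"
    and x: "\<forall>u\<in>hverts H. x u \<ge> 0" and eq: "k * edge_form H x = M * (\<Sum>u\<in>hverts H. x u ^ k)"
    and u: "u \<in> hverts H"
  shows "link_form H x u = M * x u ^ (k - 1)"
proof (rule power_minus_linear_min[OF k])
  show "x u \<ge> 0" using x u by blast
  show "link_form H x u \<ge> 0" using link_form_nonneg[OF H] x by blast
  fix s :: real assume s: "s \<ge> 0"
  let ?C = "\<Sum>w\<in>hverts H - {u}. x w ^ k" and ?B = "edge_form (delete_vertex H u) x"
  have fin: "finite (hverts H)" using uniform_hypergraphD(1)[OF H] .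
  have "(\<Sum>w\<in>hverts H - {u}. (x(u := s)) w ^ k) = ?C" by (rule sum.cong) auto
  hence "(\<Sum>w\<in>hverts H. (x(u := s)) w ^ k) = s ^ k + ?C"
    using sum.remove[OF fin u, of "\<lambda>w. (x(u := s)) w ^ k"] by simp
  moreover have "\<forall>w\<in>hverts H. (x(u := s)) w \<ge> 0" using x s by simp
  ultimately have "k * (s * link_form H x u + ?B) \<le> M * (s ^ k + ?C)"
    using M edge_form_update[OF H, of x u s] unfolding rayleigh_bound_def by metis
  moreover have "k * (x u * link_form H x u + ?B) = M * (x u ^ k + ?C)"
    using eq edge_form_split[OF H, of x u] sum.remove[OF fin u, of "\<lambda>w. x w ^ k"] by simp
  ultimately show "M * x u ^ k - k * link_form H x u * x u \<le> M * s ^ k - k * link_form H x u * s"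
    by (simp add: algebra_simps)
qed

lemma adjacency_eigenvalue_link_form:
  assumes "uniform_hypergraph k H" and "k \<ge> 1"
  shows "adjacency_eigenvalue k H \<mu> \<longleftrightarrow>
    (\<exists>x. (\<exists>u\<in>hverts H. x u \<noteq> 0) \<and> (\<forall>u\<in>hverts H. \<mu> * x u ^ (k - 1) = link_form H x u))"
  using adjacency_eigenvalue_iff[OF assms] by (simp add: link_form_def)

lemma adjacency_eigenvalue_of_real:
  fixes x :: "'a \<Rightarrow> real"
  assumes H: "uniform_hypergraph k H" and k: "k \<ge> 1" and "\<exists>u\<in>hverts H. x u \<noteq> 0"
    and eq: "\<And>u. u \<in> hverts H \<Longrightarrow> link_form H x u = \<mu> * x u ^ (k - 1)"
  shows "adjacency_eigenvalue k H (complex_of_real \<mu>)"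
  unfolding adjacency_eigenvalue_link_form[OF H k]
proof (intro exI conjI ballI)
  show "\<exists>u\<in>hverts H. complex_of_real (x u) \<noteq> 0" using assms(3) by simp
  fix u assume u: "u \<in> hverts H"
  have "link_form H (\<lambda>u. complex_of_real (x u)) u = of_real (link_form H x u)"
    by (simp add: link_form_def)
  thus "complex_of_real \<mu> * complex_of_real (x u) ^ (k - 1) = link_form H (\<lambda>u. complex_of_real (x u)) u"
    using eq[OF u] by simp
qed

text \<open>
  Multiply the triangle inequality for the eigenvalue equation at \<open>u\<close> by the modulus of the entry at
  \<open>u\<close>, sum over \<open>u\<close> and use Euler's identity.
\<close>

lemma cmod_eigenvalue_le_rayleigh_bound:
  assumes H: "uniform_hypergraph k H" and k: "k \<ge> 1" and M: "rayleigh_bound k H M"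
    and ev: "adjacency_eigenvalue k H \<mu>"
  shows "cmod \<mu> \<le> M"
proof -
  obtain x where ne: "\<exists>u\<in>hverts H. x u \<noteq> 0"
    and x: "\<And>u. u \<in> hverts H \<Longrightarrow> \<mu> * x u ^ (k - 1) = link_form H x u"
    using ev unfolding adjacency_eigenvalue_link_form[OF H k] by blast
  define y where "y u = cmod (x u)" for u
  define s where "s = (\<Sum>u\<in>hverts H. y u ^ k)"
  have "cmod \<mu> * y u ^ k \<le> y u * link_form H y u" if u: "u \<in> hverts H" for u
  proof -
    have "cmod \<mu> * y u ^ (k - 1) = cmod (link_form H x u)"
      using x[OF u, symmetric] by (simp add: y_def norm_mult norm_power)
    also have "\<dots> \<le> link_form H y u"
      unfolding link_form_def y_def prod_norm by (rule norm_sum)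
    finally have "y u * (cmod \<mu> * y u ^ (k - 1)) \<le> y u * link_form H y u"
      by (rule mult_left_mono) (simp add: y_def)
    thus ?thesis using k by (simp add: power_eq_if mult_ac)
  qed
  hence "cmod \<mu> * s \<le> (\<Sum>u\<in>hverts H. y u * link_form H y u)"
    unfolding s_def sum_distrib_left by (rule sum_mono)
  also have "\<dots> = k * edge_form H y" by (rule sum_mult_link_form[OF H])
  also have "\<dots> \<le> M * s" 
    using M[unfolded rayleigh_bound_def, rule_format, of y] by (simp add: s_def y_def)
  finally have "cmod \<mu> * s \<le> M * s" .
  moreover have "s > 0"
  proof -
    obtain u where "u \<in> hverts H" "x u \<noteq> 0" using ne by blast
    thus ?thesis unfolding s_def
      by (intro sum_pos2[of _ u]) (auto simp: y_def uniform_hypergraphD(1)[OF H])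
  qed
  ultimately show ?thesis by simp
qed

text \<open>
  The all-ones vector serves as trial vector.
\<close>

lemma rayleigh_bound_nonneg:
  assumes H: "uniform_hypergraph k H" and M: "rayleigh_bound k H M" and ne: "hverts H \<noteq> {}"
  shows "M \<ge> 0" and "k \<ge> 1 \<Longrightarrow> hedges H \<noteq> {} \<Longrightarrow> M > 0"
proof -
  have c: "card (hverts H) > 0" using ne uniform_hypergraphD(1)[OF H] by (simp add: card_gt_0_iff)
  have "k * card (hedges H) \<le> M * card (hverts H)"
    using M[unfolded rayleigh_bound_def, rule_format, of "\<lambda>_. 1"] by (simp add: edge_form_def)
  hence *: "real (k * card (hedges H)) \<le> M * card (hverts H)" by simp
  thus "M \<ge> 0" using c by (smt (verit) mult_neg_pos of_nat_0_le_iff of_nat_0_less_iff)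
  assume "k \<ge> 1" "hedges H \<noteq> {}"
  hence "real (k * card (hedges H)) > 0"
    using uniform_hypergraphD(2)[OF H] by (simp add: card_gt_0_iff)
  thus "M > 0" using * c by (smt (verit) mult_nonpos_nonneg of_nat_0_le_iff)
qed

lemma spectral_radius_rayleigh:
  assumes H: "uniform_hypergraph k H" and k: "k \<ge> 2" and ne: "hverts H \<noteq> {}"
  shows rayleigh_bound_spectral_radius: "rayleigh_bound k H (spectral_radius k H)"
    and spectral_radius_maximizer: "\<exists>x :: 'a \<Rightarrow> real. (\<forall>u\<in>hverts H. x u \<ge> 0) \<and> (\<exists>u\<in>hverts H. x u > 0) \<and>
      k * edge_form H x = spectral_radius k H * (\<Sum>u\<in>hverts H. x u ^ k)"
proof -
  have k1: "k \<ge> 1" using k by simp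
  obtain M and x :: "'a \<Rightarrow> real" where Mx: "rayleigh_bound k H M" "\<forall>u\<in>hverts H. x u \<ge> 0" "\<exists>u\<in>hverts H. x u > 0"
    "k * edge_form H x = M * (\<Sum>u\<in>hverts H. x u ^ k)"
    using rayleigh_maximum_exists[OF H k1 ne] by blast
  have "adjacency_eigenvalue k H (complex_of_real M)"
    by (rule adjacency_eigenvalue_of_real[OF H k1, of x])
      (use Mx rayleigh_maximizer_eigenvector[OF H k Mx(1,2,4)] in force)+
  moreover have "cmod (complex_of_real M) = M" using rayleigh_bound_nonneg(1)[OF H Mx(1) ne] by simp
  ultimately have "spectral_radius k H = M"
    unfolding spectral_radius_def
    by (intro Greatest_equality) (auto intro: cmod_eigenvalue_le_rayleigh_bound[OF H k1 Mx(1)] dest: sym)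
  thus "rayleigh_bound k H (spectral_radius k H)"
    "\<exists>x :: 'a \<Rightarrow> real. (\<forall>u\<in>hverts H. x u \<ge> 0) \<and> (\<exists>u\<in>hverts H. x u > 0) \<and>
      k * edge_form H x = spectral_radius k H * (\<Sum>u\<in>hverts H. x u ^ k)"
    using Mx by blast+
qed

text \<open>
  This is the comparison argument of Collatz and Wielandt: scale the positive eigenvector \<open>x\<close> until it
  dominates a maximizer \<open>y\<close> and touches it at some vertex, and compare the two eigenvalue equations
  there.
\<close>

lemma spectral_radius_positive_eigenvector:
  fixes x :: "'a \<Rightarrow> real"
  assumes H: "uniform_hypergraph k H" and k: "k \<ge> 2" and ne: "hverts H \<noteq> {}"
    and pos: "\<And>u. u \<in> hverts H \<Longrightarrow> x u > 0"
    and eig: "\<And>u. u \<in> hverts H \<Longrightarrow> link_form H x u = \<mu> * x u ^ (k - 1)"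
  shows "spectral_radius k H = \<mu>"
proof (rule antisym)
  let ?r = "spectral_radius k H"
  note R = rayleigh_bound_spectral_radius[OF H k ne]
  have k1: "k \<ge> 1" using k by simp
  have fin: "finite (hverts H)" by (rule uniform_hypergraphD(1)[OF H])
  have "adjacency_eigenvalue k H (complex_of_real \<mu>)"
    by (rule adjacency_eigenvalue_of_real[OF H k1, of x]) (use pos eig ne in force)+
  from cmod_eigenvalue_le_rayleigh_bound[OF H k1 R this] show "\<mu> \<le> ?r" by simp
  obtain y :: "'a \<Rightarrow> real" where y: "\<forall>u\<in>hverts H. y u \<ge> 0" "\<exists>u\<in>hverts H. y u > 0"
    "k * edge_form H y = ?r * (\<Sum>u\<in>hverts H. y u ^ k)"
    using spectral_radius_maximizer[OF H k ne] by blast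
  define c where "c = Max ((\<lambda>u. y u / x u) ` hverts H)"
  have cle: "y u \<le> c * x u" if "u \<in> hverts H" for u
  proof -
    have "y u / x u \<le> c" unfolding c_def using fin that by simp
    thus ?thesis using pos[OF that] by (simp add: divide_le_eq)
  qed
  have "c \<in> (\<lambda>u. y u / x u) ` hverts H" unfolding c_def using fin ne by (intro Max_in) auto
  then obtain u where u: "u \<in> hverts H" and "c = y u / x u" by blast
  hence cu: "y u = c * x u" using pos[OF u] by simp
  have yu: "y u > 0"
  proof -
    obtain w where "w \<in> hverts H" "y w > 0" using y(2) by blast
    hence "c * x w > 0" using cle by fastforce
    hence "c > 0" using pos[OF \<open>w \<in> hverts H\<close>] by (simp add: zero_less_mult_iff)
    thus ?thesis using cu pos[OF u] by simp
  qed
  have "?r * y u ^ (k - 1) = link_form H y u"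
    using rayleigh_maximizer_eigenvector[OF H k R y(1,3) u] by simp
  also have "\<dots> \<le> link_form H (\<lambda>w. c * x w) u"
    by (rule link_form_mono[OF H]) (use y cle in auto)
  also have "\<dots> = \<mu> * y u ^ (k - 1)"
    by (simp add: link_form_scale[OF H] eig[OF u] cu power_mult_distrib)
  finally show "?r \<le> \<mu>" using yu by simp
qed

lemma connected_edge_across:
  assumes "connected_hypergraph H" and "a \<in> hverts H" "b \<in> hverts H" "P a" "\<not> P b"
  obtains e c d where "e \<in> hedges H" "c \<in> e" "d \<in> e" "P c" "\<not> P d"
proof -
  have "(hadjacent H)\<^sup>*\<^sup>* a b" using assms by (auto simp: connected_hypergraph_def)
  hence "\<exists>c d. hadjacent H c d \<and> P c \<and> \<not> P d"
    using assms(4,5)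
  proof (induction rule: rtranclp_induct)
    case (step y z) thus ?case by (cases "P y") auto
  qed simp
  thus ?thesis using that by (auto simp: hadjacent_def)
qed

text \<open>
  For \<open>k > 2\<close> the eigenvalue equation at a vertex with \<open>x u = 0\<close> does not contradict the presence of
  nonzero entries, since each product may contain another zero.  Maximality does: connectedness yields
  an edge with both zero and nonzero entries, say \<open>m\<close> zeros with \<open>0 < m < k\<close>.  Raising these zeros
  to \<open>\<epsilon>\<close> increases the form by at least a multiple of \<open>\<epsilon> ^ m\<close>, but the sum of the powers only by
  \<open>m * \<epsilon> ^ k\<close>.
\<close>

lemma connected_maximizer_positive:
  fixes x :: "'a \<Rightarrow> real"
  assumes H: "uniform_hypergraph k H" and k: "k \<ge> 2" and conn: "connected_hypergraph H"
    and M: "rayleigh_bound k H M" 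
    and x: "\<forall>u\<in>hverts H. x u \<ge> 0" and ex: "\<exists>u\<in>hverts H. x u > 0"
    and eq: "k * edge_form H x = M * (\<Sum>u\<in>hverts H. x u ^ k)"
    and u: "u \<in> hverts H"
  shows "x u > 0"
proof (rule ccontr)
  assume nu: "\<not> x u > 0"
  note D = uniform_hypergraphD[OF H]
  obtain w where w: "w \<in> hverts H" "x w > 0" using ex by blast
  obtain e c d where e: "e \<in> hedges H" and c: "c \<in> e" "x c > 0" and d: "d \<in> e" "\<not> x d > 0"
    using connected_edge_across[OF conn w(1) u, of "\<lambda>u. x u > 0"] w nu by blast
  have M0: "M \<ge> 0" by (rule rayleigh_bound_nonneg(1)[OF H M]) (use u in blast)
  define Z where "Z = {i \<in> e. x i = 0}"
  define m where "m = card Z"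
  define P where "P = (\<Prod>i\<in>e - Z. x i)"
  have finZ: "finite Z" "Z \<subseteq> e" using D(5)[OF e] by (auto simp: Z_def)
  have dZ: "d \<in> Z" using d x D(3)[OF e] by (force simp: Z_def)
  have "Z \<subset> e" using c finZ by (force simp: Z_def)
  hence mk: "m < k" unfolding m_def D(4)[OF e, symmetric] by (rule psubset_card_mono[OF D(5)[OF e]])
  have P: "P > 0" unfolding P_def
    by (rule prod_pos) (use x D(3)[OF e] in \<open>force simp: Z_def\<close>)
  have "k * P \<le> 0"
  proof (rule nonpos_of_le_small_multiples)
    fix \<epsilon> :: real assume \<epsilon>: "0 < \<epsilon>" "\<epsilon> \<le> 1"
    define y where "y i = (if i \<in> Z then \<epsilon> else x i)" for i
    have xy: "0 \<le> x i" "x i \<le> y i" if "i \<in> hverts H" for i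
      using x that \<epsilon> by (auto simp: y_def Z_def)
    have y0: "\<forall>i\<in>hverts H. y i \<ge> 0" using xy by force
    have sub: "Z \<subseteq> hverts H" using finZ D(3)[OF e] by blast
    have "(\<Sum>i\<in>hverts H. y i ^ k) = (\<Sum>i\<in>hverts H - Z. y i ^ k) + (\<Sum>i\<in>Z. y i ^ k)"
      by (rule sum.subset_diff[OF sub D(1)])
    also have "(\<Sum>i\<in>hverts H - Z. y i ^ k) = (\<Sum>i\<in>hverts H - Z. x i ^ k)"
      by (rule sum.cong) (auto simp: y_def)
    also have "\<dots> = (\<Sum>i\<in>hverts H. x i ^ k)"
      by (rule sum.mono_neutral_left[OF D(1)]) (use k in \<open>auto simp: Z_def\<close>)
    also have "(\<Sum>i\<in>Z. y i ^ k) = m * \<epsilon> ^ k" by (simp add: y_def m_def)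
    finally have Sy: "(\<Sum>i\<in>hverts H. y i ^ k) = (\<Sum>i\<in>hverts H. x i ^ k) + m * \<epsilon> ^ k" .
    have py: "(\<Prod>i\<in>e. y i) = \<epsilon> ^ m * P"
    proof -
      have "(\<Prod>i\<in>e. y i) = (\<Prod>i\<in>e - Z. y i) * (\<Prod>i\<in>Z. y i)"
        by (rule prod.subset_diff[OF finZ(2) D(5)[OF e]])
      also have "(\<Prod>i\<in>e - Z. y i) = P" unfolding P_def by (rule prod.cong) (auto simp: y_def)
      also have "(\<Prod>i\<in>Z. y i) = \<epsilon> ^ m" by (simp add: y_def m_def)
      finally show ?thesis by simp
    qed
    have px: "(\<Prod>i\<in>e. x i) = 0" using dZ D(5)[OF e] d(1) by (auto simp: Z_def intro: prod_zero)
    have "(\<Sum>f\<in>hedges H - {e}. \<Prod>i\<in>f. x i) \<le> (\<Sum>f\<in>hedges H - {e}. \<Prod>i\<in>f. y i)"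
      by (intro sum_mono prod_mono) (use xy D(3) in blast)
    hence "edge_form H x + \<epsilon> ^ m * P \<le> edge_form H y"
      unfolding edge_form_def sum.remove[OF D(2) e] px py by simp
    hence "k * (edge_form H x + \<epsilon> ^ m * P) \<le> k * edge_form H y"
      by (intro mult_left_mono) auto
    also have "\<dots> \<le> M * ((\<Sum>i\<in>hverts H. x i ^ k) + m * \<epsilon> ^ k)"
      using M y0 Sy unfolding rayleigh_bound_def by metis
    finally have "k * P * \<epsilon> ^ m \<le> M * m * \<epsilon> ^ k" using eq by (simp add: algebra_simps)
    also have "\<dots> \<le> M * m * \<epsilon> ^ Suc m"
      using M0 \<epsilon> mk by (intro mult_left_mono power_decreasing) auto
    finally have "k * P * \<epsilon> ^ m \<le> (M * m * \<epsilon>) * \<epsilon> ^ m" by (simp add: mult_ac)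
    thus "k * P \<le> M * m * \<epsilon>" by (rule mult_right_le_imp_le) (use \<epsilon> in simp)
  qed
  thus False using P k by (simp add: mult_le_0_iff)
qed

section \<open>Deleting a vertex\<close>

lemma linear_edges_through_pair:
  assumes lin: "linear_hypergraph G"
    and "e \<in> hedges G" "f \<in> hedges G" "u \<in> e" "u \<in> f" "w \<in> e" "w \<in> f" "u \<noteq> w"
  shows "e = f"
proof (rule ccontr)
  assume "e \<noteq> f"
  hence c: "card (e \<inter> f) \<le> 1" "finite (e \<inter> f)" using lin assms by (auto simp: linear_hypergraph_def)
  have "card {u, w} \<le> card (e \<inter> f)" by (rule card_mono) (use c assms in auto)
  thus False using c assms by simp
qed

text \<open>
  By linearity the sets \<open>e - {v}\<close>, for the edges \<open>e\<close> through \<open>v\<close>, partition the neighbourhood of \<open>v\<close>.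
\<close>

lemma sum_edges_at_vertex:
  assumes G: "uniform_hypergraph k G" and lin: "linear_hypergraph G"
  shows "(\<Sum>e | e \<in> hedges G \<and> v \<in> e. \<Sum>w\<in>e - {v}. f w) = (\<Sum>w | hadjacent G v w. f w)"
proof -
  note D = uniform_hypergraphD[OF G]
  have "{w. hadjacent G v w} = (\<Union>e\<in>{e \<in> hedges G. v \<in> e}. e - {v})"
    by (auto simp: hadjacent_def)
  moreover have "sum f (\<Union>e\<in>{e \<in> hedges G. v \<in> e}. e - {v}) =
      (\<Sum>e | e \<in> hedges G \<and> v \<in> e. \<Sum>w\<in>e - {v}. f w)"
  proof (rule sum.UNION_disjoint)
    show "finite {e \<in> hedges G. v \<in> e}" using D(2) by simp
    show "\<forall>e\<in>{e \<in> hedges G. v \<in> e}. finite (e - {v})" using D(5) by simp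
    show "\<forall>e\<in>{e \<in> hedges G. v \<in> e}. \<forall>f\<in>{e \<in> hedges G. v \<in> e}.
        e \<noteq> f \<longrightarrow> (e - {v}) \<inter> (f - {v}) = {}"
    proof (intro ballI impI equals0I)
      fix e f w assume "e \<in> {e \<in> hedges G. v \<in> e}" "f \<in> {e \<in> hedges G. v \<in> e}"
        "e \<noteq> f" "w \<in> (e - {v}) \<inter> (f - {v})"
      thus False using linear_edges_through_pair[OF lin, of e f v w] by auto
    qed
  qed
  ultimately show ?thesis by simp
qed

text \<open>
  The free parameter \<open>b\<close> replaces the entry at \<open>v\<close>; it will be chosen so that the inequality is sharp in
  the extremal hypergraphs.
\<close>

lemma link_form_arith_geom_mean:
  fixes x :: "'a \<Rightarrow> real" and b :: real
  assumes G: "uniform_hypergraph k G" and lin: "linear_hypergraph G"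
    and pos: "\<And>u. u \<in> hverts G \<Longrightarrow> x u > 0" and b: "b > 0"
  shows link_form_arith_geom_mean_le:
      "k * b * link_form G x v \<le> hdegree G v * b ^ k + (\<Sum>w | hadjacent G v w. x w ^ k)"
    and link_form_arith_geom_mean_eq:
      "k * b * link_form G x v = hdegree G v * b ^ k + (\<Sum>w | hadjacent G v w. x w ^ k) \<Longrightarrow>
       hadjacent G v w \<Longrightarrow> x w = b"
proof -
  note D = uniform_hypergraphD[OF G]
  let ?E = "{e \<in> hedges G. v \<in> e}"
  let ?y = "x(v := b)"
  define L where "L e = (\<Prod>i\<in>e. ?y i)" for e
  define R where "R e = (\<Sum>i\<in>e. ?y i ^ k)" for e
  have ypos: "?y i > 0" if "e \<in> ?E" "i \<in> e" for e i using that pos D(3) b by auto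
  have L: "L e = b * (\<Prod>w\<in>e - {v}. x w)" and R: "R e = b ^ k + (\<Sum>w\<in>e - {v}. x w ^ k)" if "e \<in> ?E" for e
  proof -
    have e: "finite e" "v \<in> e" using that D(5) by auto
    have "(\<Prod>w\<in>e - {v}. ?y w) = (\<Prod>w\<in>e - {v}. x w)" by (rule prod.cong) auto
    thus "L e = b * (\<Prod>w\<in>e - {v}. x w)" unfolding L_def prod.remove[OF e] by simp
    have "(\<Sum>w\<in>e - {v}. ?y w ^ k) = (\<Sum>w\<in>e - {v}. x w ^ k)" by (rule sum.cong) auto
    thus "R e = b ^ k + (\<Sum>w\<in>e - {v}. x w ^ k)" unfolding R_def sum.remove[OF e] by simp
  qed
  have le: "k * L e \<le> R e" if "e \<in> ?E" for e
    using arith_geom_mean_powers_le[of e ?y] ypos[OF that] that D(4,5) by (auto simp: L_def R_def)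
  have sL: "(\<Sum>e\<in>?E. k * L e) = k * b * link_form G x v"
    unfolding link_form_def sum_distrib_left by (rule sum.cong) (simp_all add: L)
  have sR: "(\<Sum>e\<in>?E. R e) = hdegree G v * b ^ k + (\<Sum>w | hadjacent G v w. x w ^ k)"
  proof -
    have "(\<Sum>e\<in>?E. R e) = (\<Sum>e\<in>?E. b ^ k + (\<Sum>w\<in>e - {v}. x w ^ k))" by (rule sum.cong) (simp_all add: R)
    thus ?thesis by (simp add: sum.distrib hdegree_def sum_edges_at_vertex[OF G lin])
  qed
  show "k * b * link_form G x v \<le> hdegree G v * b ^ k + (\<Sum>w | hadjacent G v w. x w ^ k)"
    unfolding sL[symmetric] sR[symmetric] by (rule sum_mono) (rule le)
  assume eq: "k * b * link_form G x v = hdegree G v * b ^ k + (\<Sum>w | hadjacent G v w. x w ^ k)"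
    and "hadjacent G v w"
  then obtain e where e: "e \<in> ?E" "w \<in> e" "w \<noteq> v" by (auto simp: hadjacent_def)
  have "k * L e = R e"
    using sum_mono_inv[of "\<lambda>e. k * L e" ?E R e] eq le e D(2) unfolding sL[symmetric] sR[symmetric] by simp
  hence "?y w = ?y v"
    using arith_geom_mean_powers_eq[of e ?y w v] ypos[OF e(1)] e D(4,5) by (auto simp: L_def R_def)
  thus "x w = b" using e by simp
qed

lemma connected_edge_at_vertex:
  assumes "connected_hypergraph G" "v \<in> hverts G" "u \<in> hverts G" "u \<noteq> v"
  obtains e where "e \<in> hedges G" "v \<in> e"
  using connected_edge_across[OF assms(1,2,3), of "\<lambda>w. w = v"] assms(4) by metis

text \<open>
  The vertex \<open>u0\<close> guarantees that \<open>G - v\<close> is nonempty and, with connectedness, that some edge contains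
  \<open>v\<close>.
\<close>

lemma spectral_radius_delete_vertex:
  assumes G: "uniform_hypergraph k G" and k: "k \<ge> 2" and lin: "linear_hypergraph G"
    and conn: "connected_hypergraph G" and v: "v \<in> hverts G" and u0: "u0 \<in> hverts G" "u0 \<noteq> v"
  defines "\<rho> \<equiv> spectral_radius k G" and "\<rho>' \<equiv> spectral_radius k (delete_vertex G v)"
  defines "a \<equiv> root (k - 1) (hdegree G v / \<rho>)"
  shows spectral_radius_delete_vertex_ge: "\<rho>' \<ge> \<rho> - a"
    and spectral_radius_delete_vertex_tight: "\<rho>' = \<rho> - a \<Longrightarrow>
      (\<forall>u\<in>hverts G - {v}. hadjacent G v u) \<and> regular_hypergraph (delete_vertex G v)"
proof -
  let ?H = "delete_vertex G v" and ?N = "{w. hadjacent G v w}" and ?W = "hverts G - {v}"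
  note D = uniform_hypergraphD[OF G]
  have H: "uniform_hypergraph k ?H" by (rule uniform_delete_vertex[OF G])
  have vH: "hverts ?H = ?W" by (simp add: delete_vertex_def)
  have neG: "hverts G \<noteq> {}" and neH: "hverts ?H \<noteq> {}" using u0 by (auto simp: vH)
  have k1: "k \<ge> 1" using k by simp
  have RG: "rayleigh_bound k G \<rho>" unfolding \<rho>_def by (rule rayleigh_bound_spectral_radius[OF G k neG])
  have RH: "rayleigh_bound k ?H \<rho>'" unfolding \<rho>'_def by (rule rayleigh_bound_spectral_radius[OF H k neH])
  obtain e0 where e0: "e0 \<in> hedges G" "v \<in> e0" using connected_edge_at_vertex[OF conn v u0] .
  have d: "hdegree G v > 0" using e0 D(2) by (auto simp: hdegree_def card_gt_0_iff)
  have \<rho>: "\<rho> > 0" using rayleigh_bound_nonneg(2)[OF G RG neG k1] e0 by blast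
  have a: "a > 0" and "a ^ (k - 1) = hdegree G v / \<rho>"
    using d \<rho> k by (auto simp: a_def)
  hence da: "hdegree G v = \<rho> * a ^ (k - 1)" using \<rho> by simp
  obtain x :: "'a \<Rightarrow> real" where x: "\<forall>u\<in>hverts G. x u \<ge> 0" "\<exists>u\<in>hverts G. x u > 0"
    "k * edge_form G x = \<rho> * (\<Sum>u\<in>hverts G. x u ^ k)"
    using spectral_radius_maximizer[OF G k neG] unfolding \<rho>_def by blast
  have pos: "x u > 0" if "u \<in> hverts G" for u
    by (rule connected_maximizer_positive[OF G k conn RG x that])
  define p where "p = x v"
  define S where "S = (\<Sum>w\<in>?W. x w ^ k)"
  have p: "p > 0" using pos v by (simp add: p_def)
  have S: "S > 0" unfolding S_def by (rule sum_pos2[of _ u0]) (use D(1) u0 pos in \<open>auto intro: less_imp_le\<close>)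
  have link: "link_form G x v = \<rho> * p ^ (k - 1)"
    unfolding p_def by (rule rayleigh_maximizer_eigenvector[OF G k RG x(1,3) v])
  have pk: "p * p ^ (k - 1) = p ^ k" and ak: "a * a ^ (k - 1) = a ^ k" using k by (simp_all add: power_eq_if)
  have formH: "k * edge_form ?H x = \<rho> * S - real (k - 1) * \<rho> * p ^ k"
  proof -
    have "k * edge_form ?H x = k * edge_form G x - k * (p * link_form G x v)"
      unfolding edge_form_split[OF G, of x v] p_def by (simp add: algebra_simps)
    also have "p * link_form G x v = \<rho> * p ^ k" using pk by (simp add: link mult_ac)
    also have "k * edge_form G x = \<rho> * (p ^ k + S)"
      unfolding x(3) S_def p_def using sum.remove[OF D(1) v, of "\<lambda>u. x u ^ k"] by simp
    finally show ?thesis using k1 by (simp add: of_nat_diff algebra_simps)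
  qed
  have rayH: "k * edge_form ?H x \<le> \<rho>' * S"
    using RH x(1) unfolding rayleigh_bound_def S_def vH by simp
  \<comment> \<open>With \<open>b = p / a\<close> the degree term of the mean inequality is \<open>1 / k\<close> of its left-hand side.\<close>
  let ?b = "p / a" and ?T = "\<Sum>w\<in>?N. x w ^ k"
  have b: "?b > 0" using p a by simp
  have amgm: "k * ?b * link_form G x v = \<rho> * k * p ^ k / a" "hdegree G v * ?b ^ k = \<rho> * p ^ k / a"
  proof -
    show "k * ?b * link_form G x v = \<rho> * k * p ^ k / a" using pk by (simp add: link mult_ac)
    show "hdegree G v * ?b ^ k = \<rho> * p ^ k / a"
      unfolding power_divide ak[symmetric] da using a by simp
  qed
  have NW: "?N \<subseteq> ?W" using D(3) by (auto simp: hadjacent_def)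
  have TS: "?T \<le> S" unfolding S_def
    by (rule sum_mono2) (use D(1) NW x(1) in auto)
  have k_split: "real (k - 1) * \<rho> * p ^ k / a = \<rho> * k * p ^ k / a - \<rho> * p ^ k / a"
    using k1 by (simp add: of_nat_diff diff_divide_distrib[symmetric] algebra_simps)
  have mean: "real (k - 1) * \<rho> * p ^ k / a \<le> ?T"
    using link_form_arith_geom_mean_le[where x = x and v = v, OF G lin pos b]
    unfolding amgm k_split by simp
  have "\<rho> * S - a * S \<le> k * edge_form ?H x"
    unfolding formH using order_trans[OF mean TS] a by (simp add: divide_le_eq mult.commute)
  \<comment> \<open>Together with \<open>rayH\<close> this encloses \<open>k * edge_form ?H x\<close> between the two sides of the claim, both
    multiplied by \<open>S\<close>; equality in the claim makes all three coincide.\<close>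
  hence chain: "(\<rho> - a) * S \<le> k * edge_form ?H x" by (simp add: left_diff_distrib)
  hence "(\<rho> - a) * S \<le> \<rho>' * S" using rayH by simp
  thus "\<rho>' \<ge> \<rho> - a" using S by simp
  assume eq: "\<rho>' = \<rho> - a"
  have maxH: "k * edge_form ?H x = \<rho>' * (\<Sum>w\<in>hverts ?H. x w ^ k)"
    using chain rayH unfolding eq S_def[symmetric] vH by simp
  have "real (k - 1) * \<rho> * p ^ k = a * S"
    using maxH formH unfolding eq vH S_def[symmetric] by (simp add: algebra_simps)
  hence "real (k - 1) * \<rho> * p ^ k / a = S" using a by simp
  hence T: "?T = S" "real (k - 1) * \<rho> * p ^ k / a = ?T" using mean TS by simp_all
  have N: "?N = ?W"
  proof (rule ccontr)
    assume "?N \<noteq> ?W"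
    then obtain u where u: "u \<in> ?W" "u \<notin> ?N" using NW by blast
    have "?T < S" unfolding S_def
      by (rule sum_strict_mono2[of _ _ u]) (use D(1) NW pos u x(1) in auto)
    thus False using T by simp
  qed
  have "k * ?b * link_form G x v = hdegree G v * ?b ^ k + ?T"
    using T(2) unfolding amgm k_split by simp
  hence xb: "x w = ?b" if "w \<in> ?W" for w
    using link_form_arith_geom_mean_eq[where x = x and v = v, OF G lin pos b] that N by blast
  have "real (hdegree ?H u) = \<rho>'" if u: "u \<in> hverts ?H" for u
  proof -
    have xH: "\<forall>w\<in>hverts ?H. x w \<ge> 0" using x(1) vH by simp
    have "link_form ?H x u = link_form ?H (\<lambda>_. ?b) u"
      unfolding link_form_def
      by (intro sum.cong prod.cong) (use xb uniform_hypergraphD(3)[OF H] vH in auto)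
    moreover have "link_form ?H x u = \<rho>' * x u ^ (k - 1)"
      by (rule rayleigh_maximizer_eigenvector[OF H k RH xH maxH u])
    moreover have "x u = ?b" using xb u vH by simp
    ultimately have "?b ^ (k - 1) * real (hdegree ?H u) = ?b ^ (k - 1) * \<rho>'"
      unfolding link_form_const[OF H] using p a by auto
    thus ?thesis using p a by simp
  qed
  hence "regular_hypergraph ?H" unfolding regular_hypergraph_def by (metis of_nat_eq_iff)
  thus "(\<forall>u\<in>?W. hadjacent G v u) \<and> regular_hypergraph ?H" using N by blast
qed

text \<open>
  The eigenvector has entry \<open>a\<close> at \<open>v\<close> and \<open>1\<close> elsewhere.  A vertex \<open>u \<noteq> v\<close> lies in exactly one edge with
  \<open>v\<close>, whose product is \<open>a\<close>, and in \<open>r\<close> other edges if \<open>G - v\<close> is \<open>r\<close>-regular, so the eigenvalue must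
  be \<open>r + a\<close>.  The equation at \<open>v\<close> then reads \<open>(r + a) * a ^ (k - 1) = d(v)\<close> and is solved by the
  intermediate value theorem.
\<close>

lemma spectral_radius_delete_dominating_vertex:
  assumes G: "uniform_hypergraph k G" and k: "k \<ge> 2" and lin: "linear_hypergraph G"
    and v: "v \<in> hverts G" and u0: "u0 \<in> hverts G" "u0 \<noteq> v"
    and adj: "\<forall>u\<in>hverts G - {v}. hadjacent G v u" and reg: "regular_hypergraph (delete_vertex G v)"
  shows "spectral_radius k (delete_vertex G v) =
    spectral_radius k G - root (k - 1) (hdegree G v / spectral_radius k G)"
proof -
  let ?H = "delete_vertex G v" and ?d = "real (hdegree G v)"
  note D = uniform_hypergraphD[OF G]
  have H: "uniform_hypergraph k ?H" by (rule uniform_delete_vertex[OF G])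
  have vH: "hverts ?H = hverts G - {v}" by (simp add: delete_vertex_def)
  have neH: "hverts ?H \<noteq> {}" and neG: "hverts G \<noteq> {}" using u0 by (auto simp: vH)
  obtain r where r: "\<And>u. u \<in> hverts ?H \<Longrightarrow> hdegree ?H u = r"
    using reg unfolding regular_hypergraph_def by blast
  have \<rho>': "spectral_radius k ?H = r"
    by (rule spectral_radius_positive_eigenvector[OF H k neH, of "\<lambda>_. 1"])
      (simp_all add: link_form_const[OF H] r)
  obtain e0 where "e0 \<in> hedges G" "v \<in> e0" using adj u0 by (auto simp: hadjacent_def)
  hence d: "?d \<ge> 1" using D(2) by (simp add: hdegree_def Suc_le_eq card_gt_0_iff) blast
  have "\<exists>a::real. a \<ge> 0 \<and> a \<le> ?d \<and> (r + a) * a ^ (k - 1) = ?d"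
  proof (rule IVT'[where f = "\<lambda>a. (r + a) * a ^ (k - 1)"])
    show "(real r + 0) * 0 ^ (k - 1) \<le> ?d" using k by (simp add: zero_power)
    have "?d * 1 \<le> (r + ?d) * ?d ^ (k - 1)" using d by (intro mult_mono) auto
    thus "?d \<le> (r + ?d) * ?d ^ (k - 1)" by simp
  qed (auto intro!: continuous_intros)
  then obtain a :: real where a0: "a \<ge> 0" and ad: "(r + a) * a ^ (k - 1) = ?d" by blast
  have "a \<noteq> 0"
  proof
    assume "a = 0"
    hence "(r + a) * a ^ (k - 1) = 0" using k by simp
    thus False using ad d by linarith
  qed
  hence a: "a > 0" using a0 by simp
  let ?x = "\<lambda>w. if w = v then a else 1"
  have \<rho>: "spectral_radius k G = r + a"
  proof (rule spectral_radius_positive_eigenvector[OF G k neG, of ?x])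
    fix u assume u: "u \<in> hverts G"
    show "?x u > 0" using a by simp
    show "link_form G ?x u = (r + a) * ?x u ^ (k - 1)"
    proof (cases "u = v")
      case True
      have "link_form G ?x v = link_form G (\<lambda>_. 1) v"
        unfolding link_form_def by (intro sum.cong prod.cong) auto
      thus ?thesis using True ad by (simp add: link_form_const[OF G])
    next
      case False
      then obtain e where e: "e \<in> hedges G" "u \<in> e" "v \<in> e" using adj u by (auto simp: hadjacent_def)
      have "f = e" if "f \<in> hedges G" "u \<in> f" "v \<in> f" for f
        using linear_edges_through_pair[OF lin that(1) e(1) that(2) e(2) that(3) e(3) False] .
      hence "{f \<in> hedges G. u \<in> f} = insert e {f \<in> hedges ?H. u \<in> f}"
        using e unfolding delete_vertex_def hypergraph.simps by blast
      moreover have "e \<notin> hedges ?H" using e by (simp add: delete_vertex_def)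
      ultimately have "link_form G ?x u = (\<Prod>w\<in>e - {u}. ?x w) + link_form ?H ?x u"
        unfolding link_form_def using uniform_hypergraphD(2)[OF H] by simp
      also have "link_form ?H ?x u = link_form ?H (\<lambda>_. 1) u"
        unfolding link_form_def by (intro sum.cong prod.cong) (auto simp: delete_vertex_def)
      also have "\<dots> = r" using r u False vH by (simp add: link_form_const[OF H])
      also have "(\<Prod>w\<in>e - {u}. ?x w) = a"
      proof -
        have ve: "finite (e - {u})" "v \<in> e - {u}" using D(5) e False by auto
        have "(\<Prod>w\<in>e - {u} - {v}. ?x w) = 1" by (rule prod.neutral) auto
        thus ?thesis unfolding prod.remove[OF ve] by simp
      qed
      finally show ?thesis using False by (simp add: add.commute)
    qed
  qed
  have "?d / (r + a) = a ^ (k - 1)" using ad a by (simp add: field_simps)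
  hence "root (k - 1) (?d / spectral_radius k G) = a"
    unfolding \<rho> using a k by (simp add: real_root_power_cancel)
  thus ?thesis using \<rho> \<rho>' by simp
qed

theorem theorem4p5:
  fixes G :: "nat hypergraph" and n k v :: nat
  assumes "2 \<le> k" and "k \<le> n"
    and "uniform_hypergraph k G" and "hverts G = {1..n}"
    and "linear_hypergraph G" and "connected_hypergraph G"
    and "v \<in> {1..n}"
  shows "spectral_radius k (delete_vertex G v) \<ge>
           spectral_radius k G - root (k - 1) (real (hdegree G v) / spectral_radius k G) \<and>
         (spectral_radius k (delete_vertex G v) =
           spectral_radius k G - root (k - 1) (real (hdegree G v) / spectral_radius k G) \<longleftrightarrow>
          (\<forall>u\<in>hverts G - {v}. hadjacent G v u) \<and> regular_hypergraph (delete_vertex G v))"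
proof -
  have v: "v \<in> hverts G" using assms by simp
  obtain u0 where u0: "u0 \<in> hverts G" "u0 \<noteq> v"
  proof
    show "(if v = 1 then 2 else 1) \<in> hverts G" "(if v = 1 then 2 else 1) \<noteq> v" using assms by auto
  qed
  show ?thesis
    using spectral_radius_delete_vertex[OF assms(3,1,5,6) v u0]
      spectral_radius_delete_dominating_vertex[OF assms(3,1,5) v u0] by blast
qed

end
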